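(* Let $n \geq 1$ and let $0 < W_1 < W_2 < \cdots < W_n$ be real numbers. Let $B = [0,W_1] \times [0,W_2] \times \cdots \times [0,W_n] \subseteq \mathbb{R}^n$, and for a permutation $\pi \in S_n$ let \[ C_{\pi} = \{x \in B \;:\; x_{\pi(1)} \geq x_{\pi(2)} \geq \cdots \geq x_{\pi(n)}\}. \] Regard $\mathrm{Vol}(C_\pi)$ as a function (indeed a polynomial) of $W_1, \ldots, W_n$ on the region $0<W_1<\cdots<W_n$. Then for all $\pi, \sigma \in S_n$, $\mathrm{Vol}(C_{\pi}) = \mathrm{Vol}(C_{\sigma})$ (as functions of the $W_i$) if and only if $\psi(\pi) = \psi(\sigma)$.
   Context: For $\pi \in S_n$, its permutation matrix $[a_{ij}]_{1\le i,j\le n}$ has $a_{i,\pi(i)} = 1$ for each $i$ and all other entries $0$. The map $\psi$ from $S_n$ to the set of integer partitions sends $\pi$ to the partition whose Young diagram (in English convention, cell $(i',j')$ in row $i'$ and column $j'$) is \[ \{(i',j') \in \{1,\dots,n\}^2 \;:\; a_{ij} = 0 \text{ for all } i \leq i' \text{ and } j \leq j'\}. \] Equivalently, the $i$th part of $\psi(\pi)$ is $\min\{\pi(1),\ldots,\pi(i)\} - 1$. *)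

theory Defs
  imports "HOL-Analysis.Analysis" "HOL-Combinatorics.Permutations"
begin

definition perm_matrix :: "(nat \<Rightarrow> nat) \<Rightarrow> nat \<Rightarrow> nat \<Rightarrow> int" where
  "perm_matrix \<pi> i j = (if j = \<pi> i then 1 else 0)"

text \<open>An integer partition is the weakly decreasing list of its (positive) parts.\<close>

definition is_partition :: "nat list \<Rightarrow> bool" where
  "is_partition p \<longleftrightarrow> sorted_wrt (\<ge>) p \<and> (\<forall>k\<in>set p. 0 < k)"

text \<open>Cells are (row, column) pairs, both counted from 1, whereas list positions start at 0.\<close>

definition young_diagram :: "nat list \<Rightarrow> (nat \<times> nat) set" where
  "young_diagram p = {(i, j). i \<in> {1..length p} \<and> j \<in> {1..p ! (i - 1)}}"

definition psi_diagram :: "nat \<Rightarrow> (nat \<Rightarrow> nat) \<Rightarrow> (nat \<times> nat) set" where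
  "psi_diagram n \<pi> = {(i', j'). i' \<in> {1..n} \<and> j' \<in> {1..n} \<and>
     (\<forall>i\<in>{1..i'}. \<forall>j\<in>{1..j'}. perm_matrix \<pi> i j = 0)}"

text \<open>The description is proper for permutations: see \<open>psi_properties\<close> and \<open>psi_eq_parts\<close> below.\<close>

definition psi :: "nat \<Rightarrow> (nat \<Rightarrow> nat) \<Rightarrow> nat list" where
  "psi n \<pi> = (THE p. is_partition p \<and> young_diagram p = psi_diagram n \<pi>)"

text \<open>Points of \<open>\<real>\<^sup>n\<close> are functions on the index set \<open>{1..n}\<close>, extended by \<open>undefined\<close>.\<close>

definition box_W :: "nat \<Rightarrow> (nat \<Rightarrow> real) \<Rightarrow> (nat \<Rightarrow> real) set" where
  "box_W n W = (\<Pi>\<^sub>E i\<in>{1..n}. {0..W i})"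

definition region_C :: "nat \<Rightarrow> (nat \<Rightarrow> real) \<Rightarrow> (nat \<Rightarrow> nat) \<Rightarrow> (nat \<Rightarrow> real) set" where
  "region_C n W \<pi> = {x \<in> box_W n W. \<forall>i\<in>{1..<n}. x (\<pi> i) \<ge> x (\<pi> (Suc i))}"

definition Vol :: "nat \<Rightarrow> (nat \<Rightarrow> real) set \<Rightarrow> real" where
  "Vol n A = measure (\<Pi>\<^sub>M i\<in>{1..n}. lborel) A"

lemma young_diagram_row:
  assumes "is_partition p"
  shows "card {j. (Suc i, j) \<in> young_diagram p} = (if i < length p then p ! i else 0)"
proof -
  have "{j. (Suc i, j) \<in> young_diagram p} = (if i < length p then {1..p ! i} else {})"
    by (auto simp: young_diagram_def)
  then show ?thesis by simp
qed

lemma young_diagram_inject: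
  assumes "is_partition p" "is_partition q" "young_diagram p = young_diagram q"
  shows "p = q"
proof -
  have row: "(if i < length p then p ! i else 0) = (if i < length q then q ! i else 0)" for i
    using young_diagram_row[OF assms(1), of i] young_diagram_row[OF assms(2), of i] assms(3) by simp
  have pos: "i < length p \<Longrightarrow> 0 < p ! i" "i < length q \<Longrightarrow> 0 < q ! i" for i
    using assms(1,2) by (auto simp: is_partition_def)
  have iff: "i < length p \<longleftrightarrow> i < length q" for i
    using row[of i] pos[of i] by (auto split: if_splits)
  then have "length p = length q"
    by (metis linorder_neqE_nat less_irrefl)
  then show ?thesis
    using row by (metis nth_equalityI)
qed

lemma psi_exists:
  assumes "\<pi> permutes {1..n}"
  defines "p \<equiv> takeWhile (\<lambda>k. 0 < k) (map (\<lambda>i. Min (\<pi> ` {1..i}) - 1) [1..<Suc n])"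
  shows "is_partition p \<and> young_diagram p = psi_diagram n \<pi>"
proof -
  define f where "f i = Min (\<pi> ` {1..i}) - 1" for i
  define xs where "xs = map f [1..<Suc n]"
  have p: "p = takeWhile (\<lambda>k. 0 < k) xs"
    by (simp add: p_def xs_def f_def[abs_def])
  have range: "1 \<le> \<pi> i \<and> \<pi> i \<le> n" if "i \<in> {1..n}" for i
    using permutes_in_image[OF assms(1), of i] that by simp
  have anti: "f j \<le> f i" if "1 \<le> i" "i \<le> j" for i j
    unfolding f_def using that by (intro diff_le_mono Min_antimono) auto
  have nth_xs: "xs ! i = f (Suc i)" if "i < n" for i
    using that by (simp add: xs_def del: upt_Suc)
  have len: "length xs = n" by (simp add: xs_def)
  have lp: "length p \<le> n"
    using length_takeWhile_le[of _ xs] by (simp add: p len)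
  have nth_p: "p ! i = f (Suc i)" if "i < length p" for i
    using that lp nth_xs[of i] by (simp add: p takeWhile_nth)
  have pos: "\<forall>k\<in>set p. 0 < k"
    by (auto simp: p dest: set_takeWhileD)
  have part: "is_partition p"
    unfolding is_partition_def sorted_wrt_iff_nth_less
    using pos anti nth_p by simp
  have zero: "f i = 0" if "length p < i" "i \<le> n" for i
  proof -
    have "length p < length xs" using that len by simp
    then have "xs ! length p = 0"
      using nth_length_takeWhile[of "\<lambda>k. 0 < k" xs] by (simp add: p)
    then have "f (Suc (length p)) = 0" using nth_xs that by simp
    then show ?thesis using anti[of "Suc (length p)" i] that by simp
  qed
  have le_f: "j' \<le> f i' \<longleftrightarrow> (\<forall>i\<in>{1..i'}. j' < \<pi> i)" if "i' \<in> {1..n}" for i' j'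
  proof -
    have ne: "\<pi> ` {1..i'} \<noteq> {}" using that by simp
    have "Min (\<pi> ` {1..i'}) \<in> \<pi> ` {1..i'}" using ne by (intro Min_in) auto
    then have "1 \<le> Min (\<pi> ` {1..i'})" using range that by force
    then have "j' \<le> f i' \<longleftrightarrow> j' < Min (\<pi> ` {1..i'})" by (auto simp: f_def)
    also have "\<dots> \<longleftrightarrow> (\<forall>i\<in>{1..i'}. j' < \<pi> i)" using ne by (subst Min_gr_iff) auto
    finally show ?thesis .
  qed
  have "(i', j') \<in> young_diagram p \<longleftrightarrow> (i', j') \<in> psi_diagram n \<pi>" for i' j'
  proof -
    have "(i', j') \<in> young_diagram p \<longleftrightarrow> i' \<in> {1..n} \<and> 1 \<le> j' \<and> j' \<le> f i'"
      using lp nth_p[of "i' - 1"] zero[of i']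
      by (cases "i' \<le> length p") (auto simp: young_diagram_def)
    also have "\<dots> \<longleftrightarrow> i' \<in> {1..n} \<and> 1 \<le> j' \<and> (\<forall>i\<in>{1..i'}. j' < \<pi> i)"
      using le_f by blast
    also have "\<dots> \<longleftrightarrow> i' \<in> {1..n} \<and> j' \<in> {1..n} \<and>
        (\<forall>i\<in>{1..i'}. \<forall>j\<in>{1..j'}. perm_matrix \<pi> i j = 0)"
    proof (intro iffI conjI; (elim conjE)?)
      assume a: "i' \<in> {1..n}" "1 \<le> j'" "\<forall>i\<in>{1..i'}. j' < \<pi> i"
      then have "j' < \<pi> i'" "\<pi> i' \<le> n" using range by auto
      then have "j' \<le> n" by linarith
      then show "j' \<in> {1..n}" using a(2) by simp
    next
      assume a: "i' \<in> {1..n}" "\<forall>i\<in>{1..i'}. \<forall>j\<in>{1..j'}. perm_matrix \<pi> i j = 0"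
      show "\<forall>i\<in>{1..i'}. j' < \<pi> i"
      proof
        fix i assume i: "i \<in> {1..i'}"
        have "perm_matrix \<pi> i (\<pi> i) \<noteq> 0" by (simp add: perm_matrix_def)
        then have "\<pi> i \<notin> {1..j'}" using a(2) i by blast
        then show "j' < \<pi> i" using range[of i] i a by auto
      qed
    qed (auto simp: perm_matrix_def)
    finally show ?thesis by (simp add: psi_diagram_def)
  qed
  then show ?thesis using part by auto
qed

lemma psi_eq_parts:
  assumes "\<pi> permutes {1..n}"
  shows "psi n \<pi> = takeWhile (\<lambda>k. 0 < k) (map (\<lambda>i. Min (\<pi> ` {1..i}) - 1) [1..<Suc n])"
  unfolding psi_def using psi_exists[OF assms] young_diagram_inject
  by (intro the_equality) metis+

lemma psi_properties:
  assumes "\<pi> permutes {1..n}"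
  shows "is_partition (psi n \<pi>)" and "young_diagram (psi n \<pi>) = psi_diagram n \<pi>"
  using psi_exists[OF assms] psi_eq_parts[OF assms] by simp_all

end

theory Submission
  imports Defs
begin

text \<open>
  In the coordinates \<open>y i = x (\<pi> i)\<close> the region \<open>C\<^sub>\<pi>\<close> consists of the decreasing sequences with
  \<open>0 \<le> y i \<le> W (\<pi> i)\<close>; since \<open>y\<close> decreases and \<open>W\<close> increases, this amounts to
  \<open>y i \<le> W (Min {\<pi> 1, \<dots>, \<pi> i})\<close>, so the region depends on \<open>\<psi>(\<pi>)\<close> only.

  Conversely, let \<open>(k, t)\<close> be a cell of \<open>\<psi>(\<sigma>)\<close> but not of \<open>\<psi>(\<pi>)\<close>. Take \<open>W j\<close> in \<open>[1, 2]\<close> for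
  \<open>j \<le> t\<close> and in \<open>[L, 2L]\<close> for \<open>j > t\<close>. Then \<open>C\<^sub>\<sigma>\<close> contains a box of volume \<open>L\<^sup>k / n\<^sup>n\<close>, whereas
  \<open>C\<^sub>\<pi>\<close> is contained in a box of volume at most \<open>2\<^sup>n L\<^bsup>k-1\<^esup>\<close>, which is smaller for large \<open>L\<close>.
\<close>

section \<open>Cells of the diagram and monotone sequences\<close>

text \<open>Replaces lists by sets, so that the two inclusions can be treated separately.\<close>

lemma psi_eq_iff:
  assumes "\<pi> permutes {1..n}" "\<sigma> permutes {1..n}"
  shows "psi n \<pi> = psi n \<sigma> \<longleftrightarrow> psi_diagram n \<pi> = psi_diagram n \<sigma>"
  using psi_properties[OF assms(1)] psi_properties[OF assms(2)] young_diagram_inject by metis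

text \<open>The only nonzero entry of row \<open>i\<close> stands in column \<open>\<pi> i\<close>,
  so the first \<open>t\<close> entries of that row vanish exactly when
  \<open>t < \<pi> i\<close>.\<close>

lemma mem_psi_diagram_iff:
  assumes "\<pi> permutes {1..n}"
  shows "(k, t) \<in> psi_diagram n \<pi> \<longleftrightarrow> k \<in> {1..n} \<and> t \<in> {1..n} \<and> (\<forall>i\<in>{1..k}. t < \<pi> i)"
proof -
  have "(\<forall>j\<in>{1..t}. perm_matrix \<pi> i j = 0) \<longleftrightarrow> t < \<pi> i" if "i \<in> {1..k}" "k \<in> {1..n}" for i
  proof -
    have "\<pi> i \<in> {1..n}"
      using permutes_in_image[OF assms, of i] that by simp
    then show ?thesis by (force simp: perm_matrix_def)
  qed
  then show ?thesis by (auto simp: psi_diagram_def)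
qed

lemma decreasing_on_interval:
  fixes y :: "nat \<Rightarrow> real"
  assumes "\<forall>i\<in>{1..<n}. y (Suc i) \<le> y i" "1 \<le> i" "i \<le> j" "j \<le> n"
  shows "y j \<le> y i"
  using assms(3,4)
proof (induction j rule: dec_induct)
  case (step j)
  then have "y (Suc j) \<le> y j" using assms(1,2) by simp
  then show ?case using step by simp
qed simp

lemma increasing_on_interval:
  fixes W :: "nat \<Rightarrow> real"
  assumes "\<forall>i\<in>{1..<n}. W i < W (Suc i)" "1 \<le> i" "i \<le> j" "j \<le> n"
  shows "W i \<le> W j"
  using decreasing_on_interval[of n "\<lambda>i. - W i" i j] assms by force

section \<open>Sorted regions and permutation of coordinates\<close>

text \<open>With \<open>b = W \<circ> \<pi>\<close> this is the region of \<open>\<pi>\<close> after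
  reordering coordinates. The permutation survives only in the bounds, so the regions of two
  permutations become directly comparable.\<close>

definition sorted_region :: "nat \<Rightarrow> (nat \<Rightarrow> real) \<Rightarrow> (nat \<Rightarrow> real) set" where
  "sorted_region n b = {y \<in> (\<Pi>\<^sub>E i\<in>{1..n}. {0..b i}). \<forall>i\<in>{1..<n}. y (Suc i) \<le> y i}"

lemma sets_sorted_region: "sorted_region n b \<in> sets (\<Pi>\<^sub>M i\<in>{1..n}. lborel)"
proof -
  let ?M = "\<Pi>\<^sub>M i\<in>{1..n}. (lborel :: real measure)"
  have "(\<Pi>\<^sub>E i\<in>{1..n}. {0..b i}) \<in> sets ?M"
    by (intro sets_PiM_I_finite) auto
  moreover have "{y \<in> space ?M. \<forall>i\<in>{1..<n}. y (Suc i) \<le> y i} \<in> sets ?M"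
    by (intro sets.sets_Collect_finite_All borel_measurable_le) auto
  moreover have "sorted_region n b =
      (\<Pi>\<^sub>E i\<in>{1..n}. {0..b i}) \<inter> {y \<in> space ?M. \<forall>i\<in>{1..<n}. y (Suc i) \<le> y i}"
    by (auto simp: sorted_region_def space_PiM PiE_def)
  ultimately show ?thesis by (simp only: sets.Int)
qed

lemma permute_coordinates_measurable:
  assumes "\<pi> permutes I"
  shows "(\<lambda>x. \<lambda>i\<in>I. x (\<pi> i)) \<in> measurable (\<Pi>\<^sub>M i\<in>I. M) (\<Pi>\<^sub>M i\<in>I. M)"
  using permutes_in_image[OF assms]
  by (intro measurable_restrict measurable_component_singleton) simp

text \<open>Boxes determine the product measure, and the preimage of a box is a box with the same
  sides in another order, so the product of the side measures does not change.\<close>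

lemma distr_PiM_permute:
  fixes M :: "'b measure"
  assumes "sigma_finite_measure M" "finite I" "\<pi> permutes I"
  shows "distr (\<Pi>\<^sub>M i\<in>I. M) (\<Pi>\<^sub>M i\<in>I. M) (\<lambda>x. \<lambda>i\<in>I. x (\<pi> i)) = (\<Pi>\<^sub>M i\<in>I. M)"
proof -
  interpret product_sigma_finite "\<lambda>_. M"
    using assms(1) by (simp add: product_sigma_finite_def)
  let ?P = "\<Pi>\<^sub>M i\<in>I. M" and ?f = "\<lambda>x. \<lambda>i\<in>I. x (\<pi> i)"
  have in_I: "\<pi> i \<in> I \<longleftrightarrow> i \<in> I" for i
    using assms(3) by (rule permutes_in_image)
  have f: "?f \<in> measurable ?P ?P"
    using assms(3) by (rule permute_coordinates_measurable)
  show ?thesis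
  proof (rule PiM_eqI)
    fix A assume A: "\<And>i. i \<in> I \<Longrightarrow> A i \<in> sets M"
    let ?B = "\<lambda>i. A (inv \<pi> i)"
    have inv_in_I: "inv \<pi> i \<in> I \<longleftrightarrow> i \<in> I" for i
      using permutes_inv[OF assms(3)] by (rule permutes_in_image)
    have "?f -` Pi\<^sub>E I A \<inter> space ?P = Pi\<^sub>E I ?B"
    proof (intro equalityI subsetI)
      fix x assume x: "x \<in> ?f -` Pi\<^sub>E I A \<inter> space ?P"
      show "x \<in> Pi\<^sub>E I ?B"
      proof (rule PiE_I)
        fix i assume "i \<in> I"
        \<comment> \<open>Coordinate \<open>i\<close> of \<open>x\<close> sits at position
          \<open>inv \<pi> i\<close> of \<open>?f x\<close>.\<close>
        then have "?f x (inv \<pi> i) \<in> A (inv \<pi> i)" using x inv_in_I by blast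
        then show "x i \<in> A (inv \<pi> i)"
          using \<open>i \<in> I\<close> by (simp add: inv_in_I permutes_inverses[OF assms(3)])
      qed (use x in \<open>auto simp: space_PiM PiE_def extensional_def\<close>)
    next
      fix x assume x: "x \<in> Pi\<^sub>E I ?B"
      have "x (\<pi> i) \<in> A i" if "i \<in> I" for i
        using x that in_I[of i] by (metis PiE_mem permutes_inverses(2)[OF assms(3)])
      moreover have "x \<in> space ?P"
        using x sets.sets_into_space[OF A] unfolding space_PiM PiE_iff
        by (blast intro: inv_in_I[THEN iffD2])
      ultimately show "x \<in> ?f -` Pi\<^sub>E I A \<inter> space ?P" by auto
    qed
    then have "emeasure (distr ?P ?P ?f) (Pi\<^sub>E I A) = emeasure ?P (Pi\<^sub>E I ?B)"
      using f A assms(2) by (simp add: emeasure_distr sets_PiM_I_finite)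
    also have "\<dots> = (\<Prod>i\<in>I. emeasure M (?B i))"
      using A assms(2) by (intro emeasure_PiM) (auto simp: inv_in_I)
    also have "\<dots> = (\<Prod>i\<in>I. emeasure M (A i))"
      using prod.permute[OF permutes_inv[OF assms(3)], of "\<lambda>i. emeasure M (A i)"]
      by (simp add: comp_def)
    finally show "emeasure (distr ?P ?P ?f) (Pi\<^sub>E I A) = (\<Prod>i\<in>I. emeasure M (A i))" .
  qed (use assms(2) in simp_all)
qed

lemma region_C_eq_vimage:
  assumes "\<pi> permutes {1..n}"
  shows "region_C n W \<pi> = (\<lambda>x. \<lambda>i\<in>{1..n}. x (\<pi> i)) -` sorted_region n (W \<circ> \<pi>)
           \<inter> space (\<Pi>\<^sub>M i\<in>{1..n}. lborel)"
proof -
  have "(\<forall>i\<in>{1..n}. x (\<pi> i) \<in> {0..W (\<pi> i)}) \<longleftrightarrow> (\<forall>i\<in>{1..n}. x i \<in> {0..W i})" for x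
    by (rule bij_betw_ball[OF permutes_imp_bij[OF assms], symmetric])
  then have "x \<in> region_C n W \<pi> \<longleftrightarrow>
      x \<in> extensional {1..n} \<and> (\<lambda>i\<in>{1..n}. x (\<pi> i)) \<in> sorted_region n (W \<circ> \<pi>)" for x
    by (simp add: region_C_def box_W_def sorted_region_def PiE_iff conj_ac)
  then show ?thesis
    by (auto simp: space_PiM PiE_def)
qed

lemma Vol_region_C:
  assumes "\<pi> permutes {1..n}"
  shows "Vol n (region_C n W \<pi>) = Vol n (sorted_region n (W \<circ> \<pi>))"
proof -
  let ?M = "\<Pi>\<^sub>M i\<in>{1..n}. (lborel :: real measure)"
  have "Vol n (region_C n W \<pi>) =
      measure (distr ?M ?M (\<lambda>x. \<lambda>i\<in>{1..n}. x (\<pi> i))) (sorted_region n (W \<circ> \<pi>))"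
    unfolding Vol_def region_C_eq_vimage[OF assms]
    by (intro measure_distr[symmetric] permute_coordinates_measurable assms sets_sorted_region)
  then show ?thesis
    by (simp add: Vol_def distr_PiM_permute[OF sigma_finite_lborel _ assms] del: One_nat_def)
qed

section \<open>Comparison of sorted regions through their diagrams\<close>

text \<open>A larger diagram means larger prefix minima of the permutation, hence weaker effective
  bounds on a decreasing sequence.\<close>

lemma sorted_region_subset:
  assumes "\<pi> permutes {1..n}" "\<sigma> permutes {1..n}" "psi_diagram n \<pi> \<subseteq> psi_diagram n \<sigma>"
    and W: "\<forall>i\<in>{1..<n}. W i < W (Suc i)"
  shows "sorted_region n (W \<circ> \<pi>) \<subseteq> sorted_region n (W \<circ> \<sigma>)"
proof
  fix y assume y: "y \<in> sorted_region n (W \<circ> \<pi>)"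
  have "y i \<le> W (\<sigma> i)" if i: "i \<in> {1..n}" for i
  proof -
    have \<sigma>i: "\<sigma> i \<in> {1..n}"
      using permutes_in_image[OF assms(2), of i] i by simp
    \<comment> \<open>Otherwise \<open>(i, \<sigma> i)\<close> would be a cell of \<open>\<psi>(\<pi>)\<close>, hence of \<open>\<psi>(\<sigma>)\<close>, which it is not.\<close>
    obtain j where j: "j \<in> {1..i}" "\<pi> j \<le> \<sigma> i"
    proof (rule ccontr)
      assume "\<not> thesis"
      then have "(i, \<sigma> i) \<in> psi_diagram n \<pi>"
        using that i \<sigma>i unfolding mem_psi_diagram_iff[OF assms(1)] by (metis not_le)
      then have "(i, \<sigma> i) \<in> psi_diagram n \<sigma>"
        using assms(3) by blast
      then show False
        using i by (auto simp: mem_psi_diagram_iff[OF assms(2)] simp del: One_nat_def)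
    qed
    have "\<pi> j \<in> {1..n}"
      using permutes_in_image[OF assms(1), of j] i j by simp
    have "y i \<le> y j"
      using y i j by (intro decreasing_on_interval[of n]) (auto simp: sorted_region_def)
    also have "y j \<le> W (\<pi> j)"
      using y i j by (auto simp: sorted_region_def PiE_iff)
    also have "\<dots> \<le> W (\<sigma> i)"
      using W j \<sigma>i \<open>\<pi> j \<in> {1..n}\<close> by (intro increasing_on_interval[of n]) auto
    finally show ?thesis .
  qed
  then show "y \<in> sorted_region n (W \<circ> \<sigma>)"
    using y by (auto simp: sorted_region_def PiE_iff)
qed

section \<open>Volume bounds for sorted regions\<close>

lemma emeasure_PiE_Icc:
  fixes a b :: "nat \<Rightarrow> real"
  assumes "\<And>i. i \<in> {1..n} \<Longrightarrow> a i \<le> b i"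
  shows "emeasure (\<Pi>\<^sub>M i\<in>{1..n}. lborel) (\<Pi>\<^sub>E i\<in>{1..n}. {a i..b i}) =
    ennreal (\<Prod>i\<in>{1..n}. b i - a i)"
proof -
  interpret product_sigma_finite "\<lambda>_. lborel :: real measure"
    by unfold_locales
  show ?thesis
    using assms prod_ennreal[of "{1..n}" "\<lambda>i. b i - a i"] by (subst emeasure_PiM) auto
qed

lemma Vol_PiE_Icc:
  fixes a b :: "nat \<Rightarrow> real"
  assumes "\<And>i. i \<in> {1..n} \<Longrightarrow> a i \<le> b i"
  shows "Vol n (\<Pi>\<^sub>E i\<in>{1..n}. {a i..b i}) = (\<Prod>i\<in>{1..n}. b i - a i)"
proof -
  have "0 \<le> (\<Prod>i\<in>{1..n}. b i - a i)"
    using assms by (intro prod_nonneg) auto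
  then show ?thesis
    using emeasure_PiE_Icc[of n a b] assms by (simp add: Vol_def measure_def)
qed

text \<open>Finiteness matters for comparing volumes: \<open>measure\<close> sends infinite measure
  to 0, so it is monotone only below sets of finite measure.\<close>

lemma PiE_Icc_fmeasurable:
  fixes a b :: "nat \<Rightarrow> real"
  assumes "\<And>i. i \<in> {1..n} \<Longrightarrow> a i \<le> b i"
  shows "(\<Pi>\<^sub>E i\<in>{1..n}. {a i..b i}) \<in> fmeasurable (\<Pi>\<^sub>M i\<in>{1..n}. lborel)"
  using emeasure_PiE_Icc[of n a b] assms by (intro fmeasurableI sets_PiM_I_finite) simp_all

lemma sorted_region_fmeasurable:
  assumes "\<And>i. i \<in> {1..n} \<Longrightarrow> 0 \<le> b i"
  shows "sorted_region n b \<in> fmeasurable (\<Pi>\<^sub>M i\<in>{1..n}. lborel)"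
  by (rule fmeasurableI2[OF PiE_Icc_fmeasurable[OF assms] _ sets_sorted_region])
    (auto simp: sorted_region_def simp del: One_nat_def)

lemma prod_if_le:
  fixes c d :: real
  assumes "k \<le> n"
  shows "(\<Prod>i\<in>{1..n}. if i \<le> k then c * d else d) = c ^ k * d ^ n"
proof -
  have "(\<Prod>i\<in>{1..n}. if i \<le> k then c * d else d) =
      (\<Prod>i\<in>{1..n}. if i \<le> k then c else 1) * (\<Prod>i\<in>{1..n}. d)"
    by (subst prod.distrib[symmetric]) (auto intro!: prod.cong)
  also have "(\<Prod>i\<in>{1..n}. if i \<le> k then c else 1) = (\<Prod>i\<in>{1..k}. c)"
    using assms by (intro prod.mono_neutral_cong_right) auto
  finally show ?thesis by simp
qed

text \<open>The region contains a box whose sides are intervals stacked in decreasing order, so that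
  every point of the box is automatically sorted.\<close>

lemma Vol_sorted_region_ge:
  assumes "1 \<le> n" "k \<le> n" "1 \<le> L"
    and b: "\<And>i. i \<in> {1..n} \<Longrightarrow> (if i \<le> k then L else 1) \<le> b i"
  shows "L ^ k * (1 / n) ^ n \<le> Vol n (sorted_region n b)"
proof -
  define c where "c i = (if i \<le> k then L else 1)" for i
  \<comment> \<open>The unit interval is cut into \<open>n\<close> equal pieces, numbered from the
    top down: piece 1 ends at 1 and piece \<open>n\<close> starts at 0. Piece \<open>i\<close> is
    then stretched by \<open>c i\<close>.\<close>
  let ?lo = "\<lambda>i. c i * ((real n - i) / n)" and ?hi = "\<lambda>i. c i * ((real n - i + 1) / n)"
  have c: "1 \<le> c i" "c (Suc i) \<le> c i" for i
    using assms(3) by (auto simp: c_def)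
  have le: "?lo i \<le> ?hi i" for i
    using c[of i] assms(1) by (intro mult_left_mono) (auto simp: divide_simps)
  have "(\<Pi>\<^sub>E i\<in>{1..n}. {?lo i..?hi i}) \<subseteq> sorted_region n b"
  proof
    fix y assume y: "y \<in> (\<Pi>\<^sub>E i\<in>{1..n}. {?lo i..?hi i})"
    have yi: "?lo i \<le> y i" "y i \<le> ?hi i" if "i \<in> {1..n}" for i
      using y that by (auto simp: PiE_iff)
    have "0 \<le> y i" "y i \<le> b i" if i: "i \<in> {1..n}" for i
    proof -
      have "0 \<le> ?lo i" using c[of i] i by auto
      then show "0 \<le> y i" using yi(1)[OF i] by linarith
      have "?hi i \<le> c i * 1"
        using c[of i] i by (intro mult_left_mono) (auto simp: divide_simps)
      then show "y i \<le> b i" using yi(2)[OF i] b[OF i] by (simp add: c_def)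
    qed
    moreover have "y (Suc i) \<le> y i" if i: "i \<in> {1..<n}" for i
    proof -
      have "y (Suc i) \<le> ?hi (Suc i)" using i by (intro yi) auto
      \<comment> \<open>Before stretching, both ends are \<open>(n - i) / n\<close>; the factor
        \<open>c\<close> does not increase with the index.\<close>
      also have "\<dots> \<le> ?lo i" using c[of i] i by (intro mult_mono) (auto simp: divide_simps)
      also have "\<dots> \<le> y i" using i by (intro yi) auto
      finally show ?thesis .
    qed
    ultimately show "y \<in> sorted_region n b"
      using y by (auto simp: sorted_region_def PiE_iff)
  qed
  moreover have "0 \<le> b i" if "i \<in> {1..n}" for i
    using b[OF that] assms(3) by (auto split: if_splits)
  ultimately have "Vol n (\<Pi>\<^sub>E i\<in>{1..n}. {?lo i..?hi i}) \<le> Vol n (sorted_region n b)"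
    unfolding Vol_def using le
    by (intro measure_mono_fmeasurable sorted_region_fmeasurable fmeasurableD
        PiE_Icc_fmeasurable)
  moreover have "Vol n (\<Pi>\<^sub>E i\<in>{1..n}. {?lo i..?hi i}) = (\<Prod>i\<in>{1..n}. ?hi i - ?lo i)"
    using le by (rule Vol_PiE_Icc)
  moreover have "\<dots> = (\<Prod>i\<in>{1..n}. if i \<le> k then L * (1 / n) else 1 / n)"
    using assms(1) by (intro prod.cong) (auto simp: c_def field_simps)
  ultimately show ?thesis
    using prod_if_le[OF assms(2), of L "1 / n"] by simp
qed

text \<open>Sortedness passes the bound 2 from coordinate \<open>k\<close> to all later ones, so
  only the \<open>k - 1\<close> coordinates before it can have size of order
  \<open>L\<close>.\<close>

lemma Vol_sorted_region_le:
  assumes "k \<in> {1..n}" "1 \<le> L" "b k \<le> 2"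
    and b: "\<And>i. i \<in> {1..n} \<Longrightarrow> 0 \<le> b i \<and> b i \<le> 2 * L"
  shows "Vol n (sorted_region n b) \<le> L ^ (k - 1) * 2 ^ n"
proof -
  let ?c = "\<lambda>i. if i \<le> k - 1 then L * 2 else 2"
  have c: "0 \<le> ?c i" for i
    using assms(2) by simp
  have "sorted_region n b \<subseteq> (\<Pi>\<^sub>E i\<in>{1..n}. {0..?c i})"
  proof
    fix y assume y: "y \<in> sorted_region n b"
    have yb: "0 \<le> y i" "y i \<le> b i" if "i \<in> {1..n}" for i
      using y that by (auto simp: sorted_region_def PiE_iff)
    have "y i \<le> ?c i" if i: "i \<in> {1..n}" for i
    proof (cases "i \<le> k - 1")
      case True
      then show ?thesis using yb(2)[OF i] b[OF i] by simp
    next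
      case False
      then have "y i \<le> y k"
        using y assms(1) i by (intro decreasing_on_interval[of n]) (auto simp: sorted_region_def)
      then show ?thesis using yb(2)[OF assms(1)] assms(3) False by simp
    qed
    then show "y \<in> (\<Pi>\<^sub>E i\<in>{1..n}. {0..?c i})"
      using y yb(1) by (auto simp: sorted_region_def PiE_iff)
  qed
  then have "Vol n (sorted_region n b) \<le> Vol n (\<Pi>\<^sub>E i\<in>{1..n}. {0..?c i})"
    unfolding Vol_def using c
    by (intro measure_mono_fmeasurable sets_sorted_region PiE_Icc_fmeasurable)
  also have "\<dots> = L ^ (k - 1) * 2 ^ n"
    using prod_if_le[of "k - 1" n L 2] assms(1) by (subst Vol_PiE_Icc[OF c]) auto
  finally show ?thesis .
qed

section \<open>Separating permutations with different diagrams\<close>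

text \<open>The hypothesis on volumes is symmetric in \<open>\<pi>\<close> and
  \<open>\<sigma>\<close>, so exchanging them gives the reverse inclusion.\<close>

lemma psi_diagram_subset_if_Vol_eq:
  assumes "n \<ge> 1" "\<pi> permutes {1..n}" "\<sigma> permutes {1..n}"
    and Vol: "\<And>W :: nat \<Rightarrow> real. 0 < W 1 \<Longrightarrow> \<forall>i\<in>{1..<n}. W i < W (Suc i) \<Longrightarrow>
      Vol n (region_C n W \<pi>) = Vol n (region_C n W \<sigma>)"
  shows "psi_diagram n \<sigma> \<subseteq> psi_diagram n \<pi>"
proof (rule ccontr)
  assume "\<not> ?thesis"
  then obtain k t where kt: "(k, t) \<in> psi_diagram n \<sigma>" "(k, t) \<notin> psi_diagram n \<pi>"
    by auto
  \<comment> \<open>The cell of \<open>\<sigma>\<close> puts \<open>k\<close> and \<open>t\<close>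
    in range, so for \<open>\<pi>\<close> only the condition on its values can fail.\<close>
  then have k: "k \<in> {1..n}" and \<sigma>: "\<And>i. i \<in> {1..k} \<Longrightarrow> t < \<sigma> i"
    and "\<not> (\<forall>i\<in>{1..k}. t < \<pi> i)"
    unfolding mem_psi_diagram_iff[OF assms(2)] mem_psi_diagram_iff[OF assms(3)] by blast+
  then obtain l where l: "l \<in> {1..k}" "\<pi> l \<le> t"
    using not_less by blast
  \<comment> \<open>The two volume bounds will force \<open>L \<le> (2 * real n) ^ n\<close>; this
    value just exceeds that.\<close>
  define L :: real where "L = (2 * real n) ^ n + 1"
  \<comment> \<open>The factor \<open>1 + real j / n\<close> is strictly increasing with values in
    \<open>(1, 2]\<close> on \<open>{1..n}\<close>; it makes \<open>W\<close> strictly increasing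
    within each of the two size groups.\<close>
  define W where "W j = (if j \<le> t then 1 else L) * (1 + real j / n)" for j
  have "(2 * real n) ^ 1 \<le> (2 * real n) ^ n"
    using assms(1) by (intro power_increasing) auto
  then have L: "2 \<le> L" using assms(1) by (simp add: L_def)
  have bounds: "(if j \<le> t then 1 else L) \<le> W j" "W j \<le> (if j \<le> t then 1 else L) * 2"
    if "j \<in> {1..n}" for j
    using that L by (auto simp: W_def mult_le_cancel_left1)
  have "W j < W (Suc j)" if j: "j \<in> {1..<n}" for j
  proof (cases "j \<le> t \<and> \<not> Suc j \<le> t")
    case True
    \<comment> \<open>At the jump \<open>j = t\<close>, the small weights end at most at 2 and the
      large ones start above \<open>L\<close>.\<close>
    have "W j \<le> 2" using bounds(2)[of j] j True by simp
    also have "2 \<le> L" by (rule L)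
    also have "L < W (Suc j)" using True L j by (simp add: W_def)
    finally show ?thesis .
  next
    case False
    then have "(j \<le> t) = (Suc j \<le> t)" by auto
    then show ?thesis using L j by (auto simp: W_def divide_strict_right_mono)
  qed
  moreover have "0 < W 1" using bounds(1)[of 1] assms(1) L by (auto split: if_splits)
  ultimately have eq: "Vol n (sorted_region n (W \<circ> \<pi>)) = Vol n (sorted_region n (W \<circ> \<sigma>))"
    using Vol[of W] by (simp add: Vol_region_C[OF assms(2)] Vol_region_C[OF assms(3)] del: One_nat_def)
  have in_range: "\<pi> i \<in> {1..n}" "\<sigma> i \<in> {1..n}" if "i \<in> {1..n}" for i
    using that permutes_in_image[OF assms(2), of i] permutes_in_image[OF assms(3), of i] by auto
  have "L ^ k * (1 / n) ^ n \<le> Vol n (sorted_region n (W \<circ> \<sigma>))"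
  proof (rule Vol_sorted_region_ge)
    fix i assume i: "i \<in> {1..n}"
    show "(if i \<le> k then L else 1) \<le> (W \<circ> \<sigma>) i"
      using bounds(1)[OF in_range(2)[OF i]] \<sigma>[of i] i L by (auto split: if_splits)
  qed (use assms(1) k L in auto)
  also have "\<dots> \<le> L ^ (l - 1) * 2 ^ n"
    unfolding eq[symmetric]
  proof (rule Vol_sorted_region_le)
    show "l \<in> {1..n}" using l k by auto
    then show "(W \<circ> \<pi>) l \<le> 2" using bounds(2)[OF in_range(1)[of l]] l(2) by simp
    fix i assume "i \<in> {1..n}"
    then show "0 \<le> (W \<circ> \<pi>) i \<and> (W \<circ> \<pi>) i \<le> 2 * L"
      using bounds[OF in_range(1)[of i]] L by (auto split: if_splits)
  qed (use L in auto)
  \<comment> \<open>The small bound of \<open>\<pi>\<close> may occur at a position \<open>l\<close>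
    before \<open>k\<close>, which only lowers the exponent.\<close>
  also have "\<dots> \<le> L ^ (k - 1) * 2 ^ n"
    using l L by (intro mult_right_mono power_increasing) auto
  finally have "L ^ k * (1 / n) ^ n \<le> L ^ (k - 1) * 2 ^ n" .
  moreover have "L ^ k = L ^ (k - 1) * L"
    using k by (cases k) auto
  \<comment> \<open>Cancelling \<open>L ^ (k - 1)\<close> leaves a single factor \<open>L\<close>
    against constants depending on \<open>n\<close>.\<close>
  ultimately have "L * (1 / n) ^ n \<le> 2 ^ n"
    using L mult_le_cancel_left_pos[of "L ^ (k - 1)" "L * (1 / n) ^ n" "2 ^ n"]
    by (simp add: mult.assoc)
  then have "L \<le> (2 * real n) ^ n"
    using assms(1) by (simp add: power_divide power_mult_distrib pos_divide_le_eq)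
  then show False by (simp add: L_def)
qed

theorem theorem1:
  fixes n :: nat and \<pi> \<sigma> :: "nat \<Rightarrow> nat"
  assumes "n \<ge> 1" and "\<pi> permutes {1..n}" and "\<sigma> permutes {1..n}"
  shows "(\<forall>W :: nat \<Rightarrow> real. 0 < W 1 \<and> (\<forall>i\<in>{1..<n}. W i < W (Suc i)) \<longrightarrow>
            Vol n (region_C n W \<pi>) = Vol n (region_C n W \<sigma>))
         \<longleftrightarrow> psi n \<pi> = psi n \<sigma>"
  unfolding psi_eq_iff[OF assms(2,3)]
proof
  assume "\<forall>W :: nat \<Rightarrow> real. 0 < W 1 \<and> (\<forall>i\<in>{1..<n}. W i < W (Suc i)) \<longrightarrow>
    Vol n (region_C n W \<pi>) = Vol n (region_C n W \<sigma>)"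
  then show "psi_diagram n \<pi> = psi_diagram n \<sigma>"
    by (intro equalityI psi_diagram_subset_if_Vol_eq assms) simp_all
next
  assume "psi_diagram n \<pi> = psi_diagram n \<sigma>"
  \<comment> \<open>Here the reordered regions coincide as sets, not just in volume.\<close>
  then have "sorted_region n (W \<circ> \<pi>) = sorted_region n (W \<circ> \<sigma>)"
    if "\<forall>i\<in>{1..<n}. W i < W (Suc i)" for W
    using that by (intro equalityI sorted_region_subset assms) simp_all
  then show "\<forall>W :: nat \<Rightarrow> real. 0 < W 1 \<and> (\<forall>i\<in>{1..<n}. W i < W (Suc i)) \<longrightarrow>
    Vol n (region_C n W \<pi>) = Vol n (region_C n W \<sigma>)"
    using Vol_region_C[OF assms(2)] Vol_region_C[OF assms(3)] by metis
qed

end
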